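(* Consider a node $i$ of a gossip network tracking a source that self-updates according to a Poisson process of rate $\lambda_e>0$, under the renewal assumptions described in the context. Let $p$ be the probability that node $i$ receives the current source version within a given cycle, i.e., before the source's next self-update. Then the long-term average binary freshness of node $i$ satisfies $$\overline{F}_i=\frac{(1-p)\cdot 0+p\cdot \frac{1}{\lambda_e}}{\frac{1}{\lambda_e}}=p .$$
   Context: A source updates its own information at the epochs of a Poisson process of rate $\lambda_e$. Let $\nu_s(t)$ and $\nu_i(t)$ be the version of the information held at time $t$ by the source and by node $i$. The binary freshness of node $i$ is $F_i(t)=\mathbb{I}_{\{\nu_i(t)=\nu_s(t)\}}$, and its long-term average freshness is $$\overline{F}_i=\limsup_{T\to\infty}\frac1T\,\mathbb{E}\Big[\int_0^T F_i(t)\,dt\Big].$$ A cycle is the time interval between two consecutive source self-updates; time $0$ is the start of a cycle. The cycle lengths $C_1,C_2,\dots$ are i.i.d. exponential with rate $\lambda_e$. At the start of each cycle all nodes are stale ($F_i=0$), and the network's dissemination process restarts afresh. The dissemination clocks (Poisson processes governing source-to-node and node-to-node transmissions, whose rates may depend on which nodes are currently fresh) are independent of the source's self-update process. Thus for cycle $j$ there is a random time $D_j\in(0,\infty]$, measured from the start of the cycle, at which node $i$ would first receive the current version if no further self-update occurred. The $D_j$ are i.i.d. and independent of $(C_j)_j$. In cycle $j$, node $i$ is stale until time $D_j$ and is fresh from then until the end of the cycle if $D_j<C_j$; it is stale during the whole cycle otherwise. Hence $p=\mathbb{P}(D_j<C_j)$, the same for every $j$. *)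

theory Defs
  imports "HOL-Probability.Probability"
begin

text \<open>
  Cycles are indexed from 0: \<open>C n\<close> is the length of the \<open>n\<close>-th cycle, which occupies the time
  interval from \<open>cycle_start C n\<close> (included) to \<open>cycle_start C (Suc n)\<close> (excluded).
\<close>

definition cycle_start :: "(nat \<Rightarrow> 'a \<Rightarrow> real) \<Rightarrow> nat \<Rightarrow> 'a \<Rightarrow> real" where
  "cycle_start C n \<omega> = (\<Sum>k<n. C k \<omega>)"

text \<open>
  The version of the source is the number of self-updates up to time \<open>t\<close>. The start of the
  initial cycle counts as one, so that the version is \<open>Suc n\<close> during the \<open>n\<close>-th cycle and the
  version 0 is available for nodes that are stale from the outset.
\<close>

definition source_version :: "(nat \<Rightarrow> 'a \<Rightarrow> real) \<Rightarrow> real \<Rightarrow> 'a \<Rightarrow> nat" where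
  "source_version C t \<omega> = card {n. cycle_start C n \<omega> \<le> t}"

definition binary_freshness ::
    "(real \<Rightarrow> 'a \<Rightarrow> nat) \<Rightarrow> (real \<Rightarrow> 'a \<Rightarrow> nat) \<Rightarrow> real \<Rightarrow> 'a \<Rightarrow> real" where
  "binary_freshness \<nu>s \<nu>i t \<omega> = (if \<nu>i t \<omega> = \<nu>s t \<omega> then 1 else 0)"

definition average_freshness ::
    "'a measure \<Rightarrow> (real \<Rightarrow> 'a \<Rightarrow> nat) \<Rightarrow> (real \<Rightarrow> 'a \<Rightarrow> nat) \<Rightarrow> ereal" where
  "average_freshness M \<nu>s \<nu>i =
     Limsup at_top (\<lambda>T::real.
       ereal (1 / T * (\<integral>\<omega>. (LINT t:{0..T}|lborel. binary_freshness \<nu>s \<nu>i t \<omega>) \<partial>M)))"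

text \<open>
  \<open>D n\<close> is the delay, counted from the start of the \<open>n\<close>-th cycle, after which the node would
  first receive the current version if the source did not update itself again; it may be
  infinite. The version \<open>\<nu>\<close> held by the node is constrained only by when it agrees with the
  version of the source: which outdated version a stale node holds is left open.
\<close>

locale gossip_node = prob_space M
  for M :: "'a measure" +
  fixes lambda_e :: real
    and C :: "nat \<Rightarrow> 'a \<Rightarrow> real"
    and D :: "nat \<Rightarrow> 'a \<Rightarrow> ereal"
    and \<nu> :: "real \<Rightarrow> 'a \<Rightarrow> nat"
  assumes rate_pos: "lambda_e > 0"
    and C_exponential: "\<And>n. distributed M lborel (C n) (exponential_density lambda_e)"
    and C_indep: "indep_vars (\<lambda>_. borel) C UNIV"
    and D_pos: "\<And>n. AE \<omega> in M. 0 < D n \<omega>"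
    and D_indep: "indep_vars (\<lambda>_. borel) D UNIV"
    and D_identical: "\<And>m n. distr M borel (D m) = distr M borel (D n)"
    \<comment> \<open>\<open>indep_var\<close> wants both variables of the same type; embedding the \<open>C n\<close> into the
      extended reals does not change the sigma-algebra they generate.\<close>
    and C_D_indep:
      "indep_var (Pi\<^sub>M UNIV (\<lambda>_. borel)) (\<lambda>\<omega> n. ereal (C n \<omega>))
                 (Pi\<^sub>M UNIV (\<lambda>_. borel)) (\<lambda>\<omega> n. D n \<omega>)"
    and version_measurable:
      "(\<lambda>(t, \<omega>). \<nu> t \<omega>) \<in> measurable (borel \<Otimes>\<^sub>M M) (count_space UNIV)"
    \<comment> \<open>If \<open>C n \<omega> \<le> D n \<omega>\<close>, the right-hand side is false throughout the cycle.\<close>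
    and fresh_in_cycle:
      "AE \<omega> in M. \<forall>n t. cycle_start C n \<omega> \<le> t \<and> t < cycle_start C (Suc n) \<omega> \<longrightarrow>
         (\<nu> t \<omega> = source_version C t \<omega> \<longleftrightarrow> D n \<omega> \<le> ereal (t - cycle_start C n \<omega>))"

end

theory Submission
  imports Defs
begin

text \<open>
  Let \<open>S n\<close> be the start of cycle \<open>n\<close> and \<open>X n = min (C n) (D n)\<close> the stale part of that cycle.
  Counting every cycle that starts before \<open>T\<close> in full, also the one that \<open>T\<close> cuts off, the fresh
  time up to \<open>T\<close> is at most the sum of \<open>C n - X n\<close> over \<open>S n \<le> T\<close>, and the stale time is at most the
  sum of \<open>X n\<close> over \<open>S n \<le> T\<close>. As \<open>S n\<close> is independent of \<open>(C n, D n)\<close>, the expectations of these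
  sums are products. The Erlang densities add up to the rate \<open>\<lambda>\<close>, so the expected number of cycles
  started is \<open>1 + \<lambda> T\<close>, and memorylessness gives the means \<open>p / \<lambda>\<close> of \<open>C n - X n\<close> and
  \<open>(1 - p) / \<lambda>\<close> of \<open>X n\<close>. Hence the expected fresh time lies between \<open>p T - (1 - p) / \<lambda>\<close> and
  \<open>p T + p / \<lambda>\<close>.
\<close>

section \<open>Independence and exponential random variables\<close>

text \<open>Tonelli for the joint law, which independence makes a product. A second sample point
  \<open>\<omega>'\<close> takes the place of the two laws, so that \<open>Y\<close> is frozen while
  \<open>X\<close> is averaged.\<close>

lemma (in prob_space) nn_integral_indep_var:
  assumes indep: "indep_var S X T Y"
    and f [measurable]: "f \<in> borel_measurable (S \<Otimes>\<^sub>M T)"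
  shows "(\<integral>\<^sup>+\<omega>. f (X \<omega>, Y \<omega>) \<partial>M) = (\<integral>\<^sup>+\<omega>. (\<integral>\<^sup>+\<omega>'. f (X \<omega>', Y \<omega>) \<partial>M) \<partial>M)"
proof -
  have [measurable]: "X \<in> measurable M S" "Y \<in> measurable M T"
    and joint: "distr M S X \<Otimes>\<^sub>M distr M T Y = distr M (S \<Otimes>\<^sub>M T) (\<lambda>x. (X x, Y x))"
    using indep unfolding indep_var_distribution_eq by auto
  interpret X: prob_space "distr M S X" by (rule prob_space_distr) measurable
  interpret Y: prob_space "distr M T Y" by (rule prob_space_distr) measurable
  interpret XY: pair_sigma_finite "distr M S X" "distr M T Y" ..
  have "(\<integral>\<^sup>+\<omega>. f (X \<omega>, Y \<omega>) \<partial>M) = integral\<^sup>N (distr M S X \<Otimes>\<^sub>M distr M T Y) f"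
    by (simp add: joint nn_integral_distr)
  also have "\<dots> = (\<integral>\<^sup>+y. (\<integral>\<^sup>+x. f (x, y) \<partial>distr M S X) \<partial>distr M T Y)"
    by (subst XY.nn_integral_snd[symmetric]) auto
  also have "\<dots> = (\<integral>\<^sup>+\<omega>. (\<integral>\<^sup>+x. f (x, Y \<omega>) \<partial>distr M S X) \<partial>M)"
    by (simp add: nn_integral_distr)
  also have "\<dots> = (\<integral>\<^sup>+\<omega>. (\<integral>\<^sup>+\<omega>'. f (X \<omega>', Y \<omega>) \<partial>M) \<partial>M)"
  proof (rule nn_integral_cong)
    fix \<omega> assume "\<omega> \<in> space M"
    then have [measurable]: "Y \<omega> \<in> space T" by (rule measurable_space[rotated]) measurable
    show "(\<integral>\<^sup>+x. f (x, Y \<omega>) \<partial>distr M S X) = (\<integral>\<^sup>+\<omega>'. f (X \<omega>', Y \<omega>) \<partial>M)"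
      by (subst nn_integral_distr) auto
  qed
  finally show ?thesis .
qed

text \<open>The exponential series in \<open>l * x\<close> cancels the factor
  \<open>exp (- l * x)\<close>. The densities are those of the successive arrival times of a Poisson
  process, and their sum is its constant intensity.\<close>

lemma suminf_erlang_density:
  assumes "0 < l"
  shows "(\<Sum>k. ennreal (erlang_density k l x)) = ennreal l * indicator {0..} x"
proof (cases "x < 0")
  case False
  have "(\<lambda>k. l * exp (- l * x) * ((l * x) ^ k /\<^sub>R fact k)) sums (l * exp (- l * x) * exp (l * x))"
    by (intro sums_mult exp_converges)
  then have "(\<lambda>k. erlang_density k l x) sums l"
    using False by (simp add: erlang_density_def exp_minus field_simps)
  then have "(\<lambda>k. ennreal (erlang_density k l x)) sums ennreal l"
    using assms by (subst sums_ennreal) auto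
  then show ?thesis using False by (simp add: sums_iff)
qed (simp add: erlang_density_def)

lemma (in prob_space) nn_integral_exponential_excess:
  assumes D: "distributed M lborel X (exponential_density l)" and l: "0 < l" and r: "0 \<le> r"
  shows "(\<integral>\<^sup>+\<omega>. ennreal (X \<omega> - min (X \<omega>) r) \<partial>M) = ennreal (exp (- l * r) / l)"
proof -
  have "(\<integral>\<^sup>+\<omega>. ennreal (X \<omega> - min (X \<omega>) r) \<partial>M) =
      (\<integral>\<^sup>+x. ennreal (exponential_density l x) * ennreal (x - min x r) \<partial>lborel)"
    by (subst distributed_nn_integral[OF D, symmetric]) auto
  also have "\<dots> = (\<integral>\<^sup>+x. ennreal (exponential_density l (r + x)) * ennreal (r + x - min (r + x) r) \<partial>lborel)"
    by (subst nn_integral_real_affine[where c = 1 and t = r]) auto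
  \<comment> \<open>Memorylessness: the shift by \<open>r\<close> splits off the factor
    \<open>exp (- l * r)\<close>, and for \<open>x \<ge> 0\<close> the excess is \<open>x\<close>.
    It is written \<open>x ^ 1\<close> to match the first moment of an Erlang density.\<close>
  also have "\<dots> = (\<integral>\<^sup>+x. ennreal (exp (- l * r)) * ennreal (exponential_density l x * x ^ 1) \<partial>lborel)"
    using l r
    by (intro nn_integral_cong)
       (auto simp: erlang_density_def min_def ennreal_mult'[symmetric] mult.commute mult.left_commute
          exp_add[symmetric] algebra_simps)
  also have "\<dots> = ennreal (exp (- l * r)) * ennreal (1 / l)"
    using nn_integral_erlang_ith_moment[OF l, of 0 1] by (subst nn_integral_cmult) auto
  finally show ?thesis by (simp add: ennreal_mult'[symmetric])
qed

section \<open>The stale part of a cycle\<close>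

text \<open>Keeps the stale time real although the delay \<open>d\<close> may be infinite. For
  \<open>d > 0\<close> the minimum is finite, so \<open>real_of_ereal\<close> loses nothing; only
  \<open>d = -\<infinity>\<close> falls back to the value 0.\<close>

definition truncated :: "real \<Rightarrow> ereal \<Rightarrow> real" where
  "truncated c d = real_of_ereal (min (ereal c) d)"

lemma truncated_measurable [measurable]:
  assumes [measurable]: "f \<in> borel_measurable M" "g \<in> borel_measurable M"
  shows "(\<lambda>x. truncated (f x) (g x)) \<in> borel_measurable M"
  unfolding truncated_def by measurable

lemma truncated_bounds:
  assumes "0 < c" "0 < d"
  shows "0 \<le> truncated c d" "truncated c d \<le> c"
  using assms by (cases d; auto simp: truncated_def min_def)+

text \<open>As \<open>u < c\<close>, the minimum can be at most \<open>u\<close> only through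
  \<open>d\<close>. This turns the extended real comparison in \<open>fresh_in_cycle\<close> into
  one between reals.\<close>

lemma truncated_le_iff:
  assumes "0 < c" "0 < d" "u < c"
  shows "truncated c d \<le> u \<longleftrightarrow> d \<le> ereal u"
  using assms by (cases d) (auto simp: truncated_def min_def)

lemma (in prob_space) exponential_AE_pos:
  assumes D: "distributed M lborel X (exponential_density l)"
  shows "AE \<omega> in M. 0 < X \<omega>"
proof (subst distributed_AE2[OF D])
  \<comment> \<open>The density vanishes on the negative half-line; what remains is the point 0, a
    null set.\<close>
  show "AE x in lborel. 0 < ennreal (exponential_density l x) \<longrightarrow> 0 < x"
    using AE_lborel_singleton[of 0] by eventually_elim (auto simp: erlang_density_def)
qed auto

text \<open>For \<open>d = ereal r\<close>, both sides of the first equation are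
  \<open>exp (- l * r) / l\<close>: beyond \<open>r\<close>, the residual life again has mean
  \<open>1 / l\<close>. For infinite \<open>d\<close> both are 0. The second equation follows
  because the two parts add up to \<open>X\<close>, whose mean is \<open>1 / l\<close>.\<close>

lemma (in prob_space) nn_integral_truncated:
  assumes D: "distributed M lborel X (exponential_density l)" and l: "0 < l" and d: "0 < d"
  shows "(\<integral>\<^sup>+\<omega>. ennreal (X \<omega> - truncated (X \<omega>) d) \<partial>M) = ennreal (prob {\<omega>\<in>space M. d < ereal (X \<omega>)} / l)"
    and "(\<integral>\<^sup>+\<omega>. ennreal (truncated (X \<omega>) d) \<partial>M) = ennreal ((1 - prob {\<omega>\<in>space M. d < ereal (X \<omega>)}) / l)"
proof -
  have [measurable]: "X \<in> borel_measurable M"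
    using distributed_measurable[OF D] by simp
  show 1: "(\<integral>\<^sup>+\<omega>. ennreal (X \<omega> - truncated (X \<omega>) d) \<partial>M) = ennreal (prob {\<omega>\<in>space M. d < ereal (X \<omega>)} / l)"
  proof (cases d)
    case (real r)
    then have "0 \<le> r" using d by simp
    have "truncated (X \<omega>) d = min (X \<omega>) r" for \<omega>
      using real by (simp add: truncated_def min_def)
    then show ?thesis
      using nn_integral_exponential_excess[OF D l \<open>0 \<le> r\<close>] exponential_distributedD_gt[OF D \<open>0 \<le> r\<close> l] real
      by (simp add: mult.commute)
  qed (use d in \<open>auto simp: truncated_def\<close>)
  have "AE \<omega> in M. 0 < X \<omega>"
    by (rule exponential_AE_pos[OF D])
  then have "(\<integral>\<^sup>+\<omega>. ennreal (X \<omega> - truncated (X \<omega>) d) + ennreal (truncated (X \<omega>) d) \<partial>M) = (\<integral>\<^sup>+\<omega>. ennreal (X \<omega>) \<partial>M)"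
    using truncated_bounds d
    by (intro nn_integral_cong_AE) (auto elim!: eventually_mono simp: ennreal_plus[symmetric] simp del: ennreal_plus)
  also have "\<dots> = ennreal (1 / l)"
    using nn_integral_erlang_ith_moment[OF l, of 0 1] l
    by (subst distributed_nn_integral[OF D, symmetric]) (auto simp: ennreal_mult')
  finally have "ennreal (prob {\<omega>\<in>space M. d < ereal (X \<omega>)} / l) + (\<integral>\<^sup>+\<omega>. ennreal (truncated (X \<omega>) d) \<partial>M) = ennreal (1 / l)"
    by (subst (asm) nn_integral_add) (auto simp: 1)
  also have "\<dots> = ennreal (prob {\<omega>\<in>space M. d < ereal (X \<omega>)} / l) + ennreal ((1 - prob {\<omega>\<in>space M. d < ereal (X \<omega>)}) / l)"
    using l by (subst ennreal_plus[symmetric]) (auto simp: field_simps)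
  finally show "(\<integral>\<^sup>+\<omega>. ennreal (truncated (X \<omega>) d) \<partial>M) = ennreal ((1 - prob {\<omega>\<in>space M. d < ereal (X \<omega>)}) / l)"
    by (simp add: ennreal_add_left_cancel)
qed

section \<open>Covering a time interval\<close>

text \<open>One covering interval bounds \<open>f t\<close>, the other terms are nonnegative, and
  the sum is integrated termwise. The number \<open>s n\<close> only selects which intervals count:
  it will be the start of a cycle, and \<open>{a n..<b n}\<close> the fresh or the stale part of
  that cycle.\<close>

lemma nn_integral_interval_cover:
  fixes s a b :: "nat \<Rightarrow> real" and f :: "real \<Rightarrow> ennreal"
  assumes ab: "\<And>n. a n \<le> b n"
    and cover: "\<And>t. 0 \<le> t \<Longrightarrow> t \<le> T \<Longrightarrow> \<exists>n. s n \<le> T \<and> f t \<le> indicator {a n..<b n} t"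
  shows "(\<integral>\<^sup>+t. f t * indicator {0..T} t \<partial>lborel) \<le> (\<Sum>n. indicator {..T} (s n) * ennreal (b n - a n))"
proof -
  have "f t * indicator {0..T} t \<le> (\<Sum>n. indicator {..T} (s n) * indicator {a n..<b n} t)" for t
  proof (cases "t \<in> {0..T}")
    case True
    then obtain n where n: "s n \<le> T" "f t \<le> indicator {a n..<b n} t"
      using cover by auto
    then have "f t * indicator {0..T} t \<le> (\<Sum>m\<in>{n}. indicator {..T} (s m) * indicator {a m..<b m} t)"
      using True by simp
    also have "\<dots> \<le> (\<Sum>n. indicator {..T} (s n) * indicator {a n..<b n} t)"
      by (rule sum_le_suminf) auto
    finally show ?thesis .
  qed simp
  then have "(\<integral>\<^sup>+t. f t * indicator {0..T} t \<partial>lborel) \<le>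
      (\<integral>\<^sup>+t. (\<Sum>n. indicator {..T} (s n) * indicator {a n..<b n} t) \<partial>lborel)"
    by (intro nn_integral_mono)
  also have "\<dots> = (\<Sum>n. indicator {..T} (s n) * ennreal (b n - a n))"
    using ab by (subst nn_integral_suminf) (auto simp: nn_integral_cmult)
  finally show ?thesis .
qed

section \<open>Counting the cycles started by time \<open>T\<close>\<close>

context gossip_node
begin

lemma C_measurable [measurable]: "C n \<in> borel_measurable M"
  using distributed_measurable[OF C_exponential] by simp

lemma D_measurable [measurable]: "D n \<in> borel_measurable M"
  using D_indep by (auto simp: indep_vars_def)

lemma cycle_start_measurable [measurable]: "cycle_start C n \<in> borel_measurable M"
  unfolding cycle_start_def[abs_def] by measurable

lemma cycle_start_0 [simp]: "cycle_start C 0 \<omega> = 0"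
  by (simp add: cycle_start_def)

lemma cycle_start_Suc: "cycle_start C (Suc n) \<omega> = cycle_start C n \<omega> + C n \<omega>"
  by (simp add: cycle_start_def)

text \<open>Cycle 0 starts at time 0 and contributes the 1. Every later start is an Erlang arrival
  time; the summed densities are constantly \<open>lambda_e\<close> on \<open>{0..T}\<close>, which
  contributes \<open>lambda_e * T\<close>.\<close>

lemma nn_integral_number_of_cycles:
  assumes T: "0 \<le> T"
  shows "(\<Sum>n. \<integral>\<^sup>+\<omega>. indicator {..T} (cycle_start C n \<omega>) \<partial>M) = ennreal (1 + lambda_e * T)"
proof -
  let ?P = "\<lambda>n. \<integral>\<^sup>+\<omega>. indicator {..T} (cycle_start C n \<omega>) \<partial>M"
  have "?P (Suc n) = (\<integral>\<^sup>+x. ennreal (erlang_density n lambda_e x) * indicator {..T} x \<partial>lborel)" for n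
  proof -
    \<comment> \<open>Erlang indices count from 0: a sum of \<open>Suc n\<close> exponential
      variables has index \<open>n\<close>.\<close>
    have "distributed M lborel (\<lambda>\<omega>. \<Sum>k<Suc n. C k \<omega>) (erlang_density (card {..<Suc n} - 1) lambda_e)"
      by (rule exponential_distributed_sum)
         (use rate_pos C_exponential indep_vars_subset[OF C_indep] in auto)
    then have "distributed M lborel (cycle_start C (Suc n)) (erlang_density n lambda_e)"
      unfolding cycle_start_def[abs_def] by simp
    from distributed_nn_integral[OF this, of "indicator {..T}"] show ?thesis by simp
  qed
  then have "(\<Sum>n. ?P (Suc n)) = (\<integral>\<^sup>+x. (\<Sum>n. ennreal (erlang_density n lambda_e x) * indicator {..T} x) \<partial>lborel)"
    by (subst nn_integral_suminf) auto
  also have "\<dots> = (\<integral>\<^sup>+x. ennreal lambda_e * indicator {0..T} x \<partial>lborel)"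
    by (intro nn_integral_cong)
       (auto simp: suminf_erlang_density[OF rate_pos] split: split_indicator)
  also have "\<dots> = ennreal (lambda_e * T)"
    using T rate_pos by (simp add: nn_integral_cmult ennreal_mult)
  finally have "(\<Sum>n. ?P (Suc n)) = ennreal (lambda_e * T)" .
  moreover have "?P 0 = 1"
    using T by (simp add: emeasure_space_1)
  moreover have "(\<Sum>n. ?P n) = (\<Sum>n. ?P (n + 1)) + (\<Sum>n<1. ?P n)"
    by (rule suminf_offset) auto
  ultimately show ?thesis
    using T rate_pos by (simp add: add.commute)
qed

text \<open>The number of starts up to \<open>T\<close> has finite expectation, hence is almost
  surely finite; this excludes explosion.\<close>

lemma AE_cycle_start_unbounded: "AE \<omega> in M. \<exists>n. T < cycle_start C n \<omega>"
proof (cases "0 \<le> T")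
  case True
  have "(\<integral>\<^sup>+\<omega>. (\<Sum>n. indicator {..T} (cycle_start C n \<omega>)) \<partial>M) = ennreal (1 + lambda_e * T)"
    by (subst nn_integral_suminf) (auto simp: nn_integral_number_of_cycles[OF True])
  then have "AE \<omega> in M. (\<Sum>n. indicator {..T} (cycle_start C n \<omega>) :: ennreal) \<noteq> \<infinity>"
    by (intro nn_integral_noteq_infinite) auto
  then show ?thesis
  proof eventually_elim
    fix \<omega> assume fin: "(\<Sum>n. indicator {..T} (cycle_start C n \<omega>) :: ennreal) \<noteq> \<infinity>"
    show "\<exists>n. T < cycle_start C n \<omega>"
    proof (rule ccontr)
      assume "\<not> (\<exists>n. T < cycle_start C n \<omega>)"
      then have 1: "indicator {..T} (cycle_start C n \<omega>) = (1::ennreal)" for n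
        by (auto simp: not_less split: split_indicator)
      have "of_nat m \<le> (\<Sum>n. 1 :: ennreal)" for m
        using sum_le_suminf[of "\<lambda>_. 1 :: ennreal" "{..<m}"] by simp
      then have "(\<Sum>n. 1 :: ennreal) = \<infinity>"
        by (metis ennreal_Ex_less_of_nat infinity_ennreal_def not_le top.not_eq_extremum)
      with fin show False by (simp add: 1)
    qed
  qed
next
  case False
  then show ?thesis by (auto intro!: AE_I2 exI[of _ 0])
qed

section \<open>Expected rewards per cycle\<close>

text \<open>The start of cycle \<open>n\<close> involves only earlier lengths, so it is independent
  of \<open>C n\<close>, and the lengths are jointly independent of the delays. Of the two uses of
  \<open>nn_integral_indep_var\<close>, the first freezes \<open>D n\<close> and the second
  separates the start from \<open>C n\<close>.\<close>

lemma nn_integral_cycle_start_indep: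
  assumes [measurable]: "h \<in> borel_measurable (borel \<Otimes>\<^sub>M borel)"
  shows "(\<integral>\<^sup>+\<omega>. indicator {..T} (cycle_start C n \<omega>) * h (C n \<omega>, D n \<omega>) \<partial>M) =
    (\<integral>\<^sup>+\<omega>. indicator {..T} (cycle_start C n \<omega>) \<partial>M) *
    (\<integral>\<^sup>+\<omega>. (\<integral>\<^sup>+\<omega>'. h (C n \<omega>', D n \<omega>) \<partial>M) \<partial>M)"
proof -
  let ?I = "indicator {..T} :: real \<Rightarrow> ennreal"
  \<comment> \<open>\<open>C_D_indep\<close> speaks of whole sequences, so the integrand is made a
    function of two sequences; \<open>real_of_ereal\<close> undoes the embedding of the
    lengths.\<close>
  define f :: "(nat \<Rightarrow> ereal) \<times> (nat \<Rightarrow> ereal) \<Rightarrow> ennreal" where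
    "f = (\<lambda>(x, y). ?I (\<Sum>k<n. real_of_ereal (x k)) * h (real_of_ereal (x n), y n))"
  have f [measurable]: "f \<in> borel_measurable (Pi\<^sub>M UNIV (\<lambda>_. borel) \<Otimes>\<^sub>M Pi\<^sub>M UNIV (\<lambda>_. borel))"
    unfolding f_def by measurable
  have "(\<integral>\<^sup>+\<omega>. ?I (cycle_start C n \<omega>) * h (C n \<omega>, D n \<omega>) \<partial>M) =
      (\<integral>\<^sup>+\<omega>. (\<integral>\<^sup>+\<omega>'. ?I (cycle_start C n \<omega>') * h (C n \<omega>', D n \<omega>) \<partial>M) \<partial>M)"
    using nn_integral_indep_var[OF C_D_indep f] by (simp add: f_def cycle_start_def)
  also have "\<dots> = (\<integral>\<^sup>+\<omega>. (\<integral>\<^sup>+\<omega>'. ?I (cycle_start C n \<omega>') \<partial>M) * (\<integral>\<^sup>+\<omega>'. h (C n \<omega>', D n \<omega>) \<partial>M) \<partial>M)"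
  proof (rule nn_integral_cong)
    fix \<omega> assume "\<omega> \<in> space M"
    have ind: "indep_var borel (C n) borel (cycle_start C n)"
      unfolding cycle_start_def[abs_def]
      by (rule indep_vars_sum) (auto intro: indep_vars_subset[OF C_indep])
    have "(\<integral>\<^sup>+\<omega>'. ?I (cycle_start C n \<omega>') * h (C n \<omega>', D n \<omega>) \<partial>M) =
        (\<integral>\<^sup>+\<omega>''. (\<integral>\<^sup>+\<omega>'. ?I (cycle_start C n \<omega>'') * h (C n \<omega>', D n \<omega>) \<partial>M) \<partial>M)"
      using nn_integral_indep_var[OF ind, of "\<lambda>(c, s). ?I s * h (c, D n \<omega>)"] by simp
    then show "(\<integral>\<^sup>+\<omega>'. ?I (cycle_start C n \<omega>') * h (C n \<omega>', D n \<omega>) \<partial>M) =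
        (\<integral>\<^sup>+\<omega>'. ?I (cycle_start C n \<omega>') \<partial>M) * (\<integral>\<^sup>+\<omega>'. h (C n \<omega>', D n \<omega>) \<partial>M)"
      by (simp add: nn_integral_cmult nn_integral_multc)
  qed
  also have "\<dots> = (\<integral>\<^sup>+\<omega>. ?I (cycle_start C n \<omega>) \<partial>M) * (\<integral>\<^sup>+\<omega>. (\<integral>\<^sup>+\<omega>'. h (C n \<omega>', D n \<omega>) \<partial>M) \<partial>M)"
    by (subst nn_integral_cmult) auto
  finally show ?thesis .
qed

abbreviation delay :: "nat \<Rightarrow> 'a \<Rightarrow> real" where
  "delay n \<omega> \<equiv> truncated (C n \<omega>) (D n \<omega>)"

text \<open>Freezing the delay expresses the probability through the tail of the exponential law.
  Neither this tail nor the law of the delay depends on the cycle, which is why \<open>j\<close> may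
  be exchanged for \<open>n\<close>.\<close>

lemma prob_receive_eq:
  "ennreal (prob {\<omega>\<in>space M. D j \<omega> < ereal (C j \<omega>)}) =
    (\<integral>\<^sup>+\<omega>. ennreal (prob {\<omega>'\<in>space M. D n \<omega> < ereal (C n \<omega>')}) \<partial>M)"
proof -
  define q where "q d = emeasure (density lborel (exponential_density lambda_e)) {c. d < ereal c}" for d
  have q: "emeasure M {\<omega>'\<in>space M. d < ereal (C k \<omega>')} = q d" for d k
    unfolding q_def distributed_distr_eq_density[OF C_exponential[of k], symmetric]
    by (subst emeasure_distr) (auto intro!: arg_cong[where f = "emeasure M"])
  \<comment> \<open>\<open>q d\<close> is the measure of the section at \<open>d\<close> of a
    measurable set of pairs, hence measurable in \<open>d\<close>.\<close>
  have qm [measurable]: "q \<in> borel_measurable borel"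
  proof -
    interpret E: prob_space "density lborel (exponential_density lambda_e)"
      by (rule prob_space_exponential_density[OF rate_pos])
    have "(\<lambda>d. emeasure (density lborel (exponential_density lambda_e))
        (Pair d -` {x \<in> space (borel \<Otimes>\<^sub>M density lborel (exponential_density lambda_e)). fst x < ereal (snd x)})) \<in> borel_measurable borel"
      by (rule E.measurable_emeasure_Pair) measurable
    then show ?thesis
      by (simp add: q_def[abs_def] space_pair_measure)
  qed
  let ?J = "indicator {x. snd x < ereal (fst x)} :: real \<times> ereal \<Rightarrow> ennreal"
  have J [measurable]: "?J \<in> borel_measurable (borel \<Otimes>\<^sub>M borel)"
    by measurable
  have *: "(\<integral>\<^sup>+\<omega>. ?J (X \<omega>, Y \<omega>) \<partial>M) = (\<integral>\<^sup>+\<omega>. indicator {\<omega>\<in>space M. Y \<omega> < ereal (X \<omega>)} \<omega> \<partial>M)"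
    for X Y
    by (intro nn_integral_cong) (auto split: split_indicator)
  have "ennreal (prob {\<omega>\<in>space M. D j \<omega> < ereal (C j \<omega>)}) =
      (\<integral>\<^sup>+\<omega>. ?J (C j \<omega>, D j \<omega>) \<partial>M)"
    by (subst *) (simp add: emeasure_eq_measure)
  also have "\<dots> = (\<integral>\<^sup>+\<omega>. (\<integral>\<^sup>+\<omega>'. ?J (C j \<omega>', D j \<omega>) \<partial>M) \<partial>M)"
    using nn_integral_indep_var[OF C_D_indep, of "\<lambda>(x, y). ?J (real_of_ereal (x j), y j)"]
    by simp
  also have "\<dots> = (\<integral>\<^sup>+\<omega>. q (D j \<omega>) \<partial>M)"
  proof (rule nn_integral_cong)
    fix \<omega>
    show "(\<integral>\<^sup>+\<omega>'. ?J (C j \<omega>', D j \<omega>) \<partial>M) = q (D j \<omega>)"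
      by (subst *) (simp add: q)
  qed
  also have "\<dots> = (\<integral>\<^sup>+d. q d \<partial>distr M borel (D j))"
    by (simp add: nn_integral_distr)
  also have "\<dots> = (\<integral>\<^sup>+d. q d \<partial>distr M borel (D n))"
    by (simp add: D_identical[of j n])
  also have "\<dots> = (\<integral>\<^sup>+\<omega>. ennreal (prob {\<omega>'\<in>space M. D n \<omega> < ereal (C n \<omega>')}) \<partial>M)"
    by (simp add: nn_integral_distr q emeasure_eq_measure[symmetric])
  finally show ?thesis .
qed

text \<open>At a frozen delay both means are affine in the chance \<open>?q\<close> of reception, by
  \<open>nn_integral_truncated\<close>; averaging over the delay replaces \<open>?q\<close> by
  \<open>p\<close>.\<close>

lemma nn_integral_cycle_rewards:
  assumes p: "p = prob {\<omega>\<in>space M. D j \<omega> < ereal (C j \<omega>)}"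
  shows "(\<integral>\<^sup>+\<omega>. (\<integral>\<^sup>+\<omega>'. ennreal (C n \<omega>' - truncated (C n \<omega>') (D n \<omega>)) \<partial>M) \<partial>M) = ennreal (p / lambda_e)"
    and "(\<integral>\<^sup>+\<omega>. (\<integral>\<^sup>+\<omega>'. ennreal (truncated (C n \<omega>') (D n \<omega>)) \<partial>M) \<partial>M) = ennreal ((1 - p) / lambda_e)"
proof -
  let ?q = "\<lambda>\<omega>. prob {\<omega>'\<in>space M. D n \<omega> < ereal (C n \<omega>')}"
  have qm [measurable]: "?q \<in> borel_measurable M"
    by measurable
  have ep: "(\<integral>\<^sup>+\<omega>. ennreal (?q \<omega>) \<partial>M) = ennreal p"
    unfolding p by (rule prob_receive_eq[symmetric])
  have "(\<integral>\<^sup>+\<omega>. (\<integral>\<^sup>+\<omega>'. ennreal (C n \<omega>' - truncated (C n \<omega>') (D n \<omega>)) \<partial>M) \<partial>M) = (\<integral>\<^sup>+\<omega>. ennreal (1 / lambda_e) * ennreal (?q \<omega>) \<partial>M)"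
    using D_pos[of n] rate_pos
    by (intro nn_integral_cong_AE)
       (auto elim!: eventually_mono simp: nn_integral_truncated(1)[OF C_exponential rate_pos] ennreal_mult'[symmetric])
  also have "\<dots> = ennreal (p / lambda_e)"
    using rate_pos by (subst nn_integral_cmult) (auto simp: ep ennreal_mult'[symmetric])
  finally show "(\<integral>\<^sup>+\<omega>. (\<integral>\<^sup>+\<omega>'. ennreal (C n \<omega>' - truncated (C n \<omega>') (D n \<omega>)) \<partial>M) \<partial>M) = ennreal (p / lambda_e)" .
  \<comment> \<open>Instead of subtracting nonnegative integrals, the finite value
    \<open>ennreal p\<close> is added on both sides and cancelled.\<close>
  have "(\<integral>\<^sup>+\<omega>. ennreal (1 - ?q \<omega>) \<partial>M) + ennreal p = (\<integral>\<^sup>+\<omega>. ennreal (1 - ?q \<omega>) + ennreal (?q \<omega>) \<partial>M)"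
    by (subst nn_integral_add) (auto simp: ep)
  also have "\<dots> = (\<integral>\<^sup>+\<omega>. 1 \<partial>M)"
    by (intro nn_integral_cong) (auto simp: ennreal_plus[symmetric] simp del: ennreal_plus)
  also have "\<dots> = ennreal (1 - p) + ennreal p"
    by (subst ennreal_plus[symmetric]) (auto simp: p emeasure_space_1)
  finally have eq: "(\<integral>\<^sup>+\<omega>. ennreal (1 - ?q \<omega>) \<partial>M) = ennreal (1 - p)"
    by (simp add: ennreal_add_left_cancel add.commute)
  have "(\<integral>\<^sup>+\<omega>. (\<integral>\<^sup>+\<omega>'. ennreal (truncated (C n \<omega>') (D n \<omega>)) \<partial>M) \<partial>M) = (\<integral>\<^sup>+\<omega>. ennreal (1 / lambda_e) * ennreal (1 - ?q \<omega>) \<partial>M)"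
    using D_pos[of n] rate_pos
    by (intro nn_integral_cong_AE)
       (auto elim!: eventually_mono simp: nn_integral_truncated(2)[OF C_exponential rate_pos] ennreal_mult'[symmetric])
  also have "\<dots> = ennreal ((1 - p) / lambda_e)"
    using rate_pos by (subst nn_integral_cmult) (auto simp: eq ennreal_mult'[symmetric])
  finally show "(\<integral>\<^sup>+\<omega>. (\<integral>\<^sup>+\<omega>'. ennreal (truncated (C n \<omega>') (D n \<omega>)) \<partial>M) \<partial>M) = ennreal ((1 - p) / lambda_e)" .
qed

text \<open>A form of Wald's identity: whether cycle \<open>n\<close> starts by \<open>T\<close> is
  decided by earlier cycles, so every term factors into the probability of a start and the mean
  reward \<open>r\<close>.\<close>

lemma nn_integral_reward_sum:
  assumes T: "0 \<le> T" and r: "0 \<le> r"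
    and [measurable]: "h \<in> borel_measurable (borel \<Otimes>\<^sub>M borel)"
    and mean: "\<And>n. (\<integral>\<^sup>+\<omega>. (\<integral>\<^sup>+\<omega>'. h (C n \<omega>', D n \<omega>) \<partial>M) \<partial>M) = ennreal r"
  shows "(\<integral>\<^sup>+\<omega>. (\<Sum>n. indicator {..T} (cycle_start C n \<omega>) * h (C n \<omega>, D n \<omega>)) \<partial>M) =
    ennreal ((1 + lambda_e * T) * r)"
proof -
  have "(\<integral>\<^sup>+\<omega>. (\<Sum>n. indicator {..T} (cycle_start C n \<omega>) * h (C n \<omega>, D n \<omega>)) \<partial>M) =
      (\<Sum>n. (\<integral>\<^sup>+\<omega>. indicator {..T} (cycle_start C n \<omega>) \<partial>M) * ennreal r)"
    by (subst nn_integral_suminf) (simp_all add: nn_integral_cycle_start_indep mean)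
  also have "\<dots> = ennreal (1 + lambda_e * T) * ennreal r"
    by (simp add: nn_integral_number_of_cycles[OF T])
  finally show ?thesis
    using r by (simp add: ennreal_mult'')
qed

section \<open>Freshness along a sample path\<close>

text \<open>The starts almost surely pass \<open>T\<close>, and the cycle containing
  \<open>t\<close> is the one before the first start after \<open>t\<close>. Asking for
  \<open>T\<close> rather than \<open>t\<close> gives one null set for all these times.\<close>

lemma AE_cycle_cover:
  "AE \<omega> in M. \<forall>t. 0 \<le> t \<and> t \<le> T \<longrightarrow>
    (\<exists>n. cycle_start C n \<omega> \<le> t \<and> t < cycle_start C (Suc n) \<omega>)"
  using AE_cycle_start_unbounded[of T]
proof eventually_elim
  case (elim \<omega>)
  show ?case
  proof (intro allI impI)
    fix t assume t: "0 \<le> t \<and> t \<le> T"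
    define m where "m = (LEAST n. t < cycle_start C n \<omega>)"
    have ex: "\<exists>n. t < cycle_start C n \<omega>" using elim t by (metis order_le_less_trans)
    then have m: "t < cycle_start C m \<omega>" unfolding m_def by (rule LeastI_ex)
    \<comment> \<open>\<open>m\<close> is not 0 because cycle 0 starts at time 0, which is not after
      \<open>t\<close>.\<close>
    then obtain k where k: "m = Suc k" using t by (cases m) auto
    have "\<not> t < cycle_start C k \<omega>"
      using not_less_Least[of k "\<lambda>n. t < cycle_start C n \<omega>"] k by (simp add: m_def)
    then show "\<exists>n. cycle_start C n \<omega> \<le> t \<and> t < cycle_start C (Suc n) \<omega>"
      using m k by (auto simp: not_less)
  qed
qed

abbreviation "F t \<omega> \<equiv> binary_freshness (source_version C) \<nu> t \<omega>"

lemma freshness_bounds: "0 \<le> F t \<omega>" "F t \<omega> \<le> 1"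
  by (auto simp: binary_freshness_def)

lemma freshness_measurable: "(\<lambda>(\<omega>, t). F t \<omega>) \<in> borel_measurable (M \<Otimes>\<^sub>M lborel)"
proof -
  have "(\<lambda>x. source_version C (snd x) (fst x)) \<in> measurable (M \<Otimes>\<^sub>M lborel) (count_space UNIV)"
    unfolding source_version_def by measurable
  moreover have "(\<lambda>x. \<nu> (snd x) (fst x)) \<in> measurable (M \<Otimes>\<^sub>M lborel) (count_space UNIV)"
  proof -
    have "(\<lambda>x. (snd x, fst x)) \<in> measurable (M \<Otimes>\<^sub>M lborel) (borel \<Otimes>\<^sub>M M)" by measurable
    from measurable_compose[OF this version_measurable] show ?thesis by simp
  qed
  \<comment> \<open>Equality of the versions becomes a countable union over their common value,
    which reduces its measurability to that of each version.\<close>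
  ultimately have "Measurable.pred (M \<Otimes>\<^sub>M lborel) (\<lambda>x. \<exists>k. \<nu> (snd x) (fst x) = k \<and> source_version C (snd x) (fst x) = k)"
    by measurable
  then have [measurable]: "Measurable.pred (M \<Otimes>\<^sub>M lborel) (\<lambda>x. \<nu> (snd x) (fst x) = source_version C (snd x) (fst x))"
    by (simp add: eq_commute)
  show ?thesis
    unfolding binary_freshness_def split_beta' by measurable
qed

lemma freshness_integral_bounds:
  assumes T: "0 \<le> T"
  shows "AE \<omega> in M. (\<integral>\<^sup>+t. ennreal (F t \<omega>) * indicator {0..T} t \<partial>lborel) \<le>
      (\<Sum>n. indicator {..T} (cycle_start C n \<omega>) * ennreal (C n \<omega> - delay n \<omega>))"
    and "AE \<omega> in M. (\<integral>\<^sup>+t. ennreal (1 - F t \<omega>) * indicator {0..T} t \<partial>lborel) \<le>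
      (\<Sum>n. indicator {..T} (cycle_start C n \<omega>) * ennreal (delay n \<omega>))"
proof -
  have pos: "AE \<omega> in M. \<forall>n. 0 < C n \<omega> \<and> 0 < D n \<omega>"
    unfolding AE_all_countable using D_pos exponential_AE_pos[OF C_exponential] by auto
  \<comment> \<open>If nothing arrives in cycle \<open>n\<close>, then
    \<open>delay n \<omega>\<close> equals \<open>C n \<omega>\<close> and the condition of the
    \<open>if\<close> fails throughout the cycle, so one formula covers both kinds of cycle.\<close>
  have *: "AE \<omega> in M. (\<forall>n. 0 \<le> delay n \<omega> \<and> delay n \<omega> \<le> C n \<omega>) \<and>
      (\<forall>t. 0 \<le> t \<and> t \<le> T \<longrightarrow> (\<exists>n. cycle_start C n \<omega> \<le> t \<and> t < cycle_start C n \<omega> + C n \<omega> \<and>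
        F t \<omega> = (if cycle_start C n \<omega> + delay n \<omega> \<le> t then 1 else 0)))"
    using pos AE_cycle_cover[of T] fresh_in_cycle
  proof eventually_elim
    case (elim \<omega>)
    have "\<exists>n. cycle_start C n \<omega> \<le> t \<and> t < cycle_start C n \<omega> + C n \<omega> \<and>
        F t \<omega> = (if cycle_start C n \<omega> + delay n \<omega> \<le> t then 1 else 0)" if t: "0 \<le> t" "t \<le> T" for t
    proof -
      obtain n where n: "cycle_start C n \<omega> \<le> t" "t < cycle_start C (Suc n) \<omega>"
        using elim(2) t by blast
      then have "\<nu> t \<omega> = source_version C t \<omega> \<longleftrightarrow> D n \<omega> \<le> ereal (t - cycle_start C n \<omega>)"
        using elim(3) by auto
      also have "\<dots> \<longleftrightarrow> delay n \<omega> \<le> t - cycle_start C n \<omega>"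
        using elim(1) n by (subst truncated_le_iff) (auto simp: cycle_start_Suc)
      finally show ?thesis
        using n by (intro exI[of _ n]) (auto simp: binary_freshness_def cycle_start_Suc)
    qed
    moreover have "\<forall>n. 0 \<le> delay n \<omega> \<and> delay n \<omega> \<le> C n \<omega>"
      using truncated_bounds elim(1) by auto
    ultimately show ?case by auto
  qed
  show "AE \<omega> in M. (\<integral>\<^sup>+t. ennreal (F t \<omega>) * indicator {0..T} t \<partial>lborel) \<le>
      (\<Sum>n. indicator {..T} (cycle_start C n \<omega>) * ennreal (C n \<omega> - delay n \<omega>))"
    using *
  proof eventually_elim
    case (elim \<omega>)
    let ?S = "\<lambda>n. cycle_start C n \<omega>"
    \<comment> \<open>The length of the fresh part is written as a difference of end points to fit
      the covering lemma; \<open>?S n\<close> cancels afterwards.\<close>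
    have "(\<integral>\<^sup>+t. ennreal (F t \<omega>) * indicator {0..T} t \<partial>lborel) \<le>
        (\<Sum>n. indicator {..T} (?S n) * ennreal ((?S n + C n \<omega>) - (?S n + delay n \<omega>)))"
    proof (rule nn_integral_interval_cover)
      fix t assume "0 \<le> t" "t \<le> T"
      then obtain n where "?S n \<le> t" "t < ?S n + C n \<omega>"
          "F t \<omega> = (if ?S n + delay n \<omega> \<le> t then 1 else 0)"
        using elim by blast
      then show "\<exists>n. ?S n \<le> T \<and> ennreal (F t \<omega>) \<le> indicator {?S n + delay n \<omega>..<?S n + C n \<omega>} t"
        using \<open>t \<le> T\<close> by (intro exI[of _ n]) auto
    qed (use elim in auto)
    then show ?case by simp
  qed
  show "AE \<omega> in M. (\<integral>\<^sup>+t. ennreal (1 - F t \<omega>) * indicator {0..T} t \<partial>lborel) \<le>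
      (\<Sum>n. indicator {..T} (cycle_start C n \<omega>) * ennreal (delay n \<omega>))"
    using *
  proof eventually_elim
    case (elim \<omega>)
    let ?S = "\<lambda>n. cycle_start C n \<omega>"
    have "(\<integral>\<^sup>+t. ennreal (1 - F t \<omega>) * indicator {0..T} t \<partial>lborel) \<le>
        (\<Sum>n. indicator {..T} (?S n) * ennreal ((?S n + delay n \<omega>) - ?S n))"
    proof (rule nn_integral_interval_cover)
      fix t assume "0 \<le> t" "t \<le> T"
      then obtain n where "?S n \<le> t" "t < ?S n + C n \<omega>"
          "F t \<omega> = (if ?S n + delay n \<omega> \<le> t then 1 else 0)"
        using elim by blast
      then show "\<exists>n. ?S n \<le> T \<and> ennreal (1 - F t \<omega>) \<le> indicator {?S n..<?S n + delay n \<omega>} t"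
        using \<open>t \<le> T\<close> by (intro exI[of _ n]) auto
    qed (use elim in auto)
    then show ?case by simp
  qed
qed

section \<open>Expected fresh time and its long-run average\<close>

text \<open>Both claims come from upper bounds on nonnegative integrals: of the fresh time for the
  first, of the stale time \<open>T - B\<close> for the second.\<close>

lemma expected_freshness_bounds:
  assumes T: "0 \<le> T" and p: "p = prob {\<omega>\<in>space M. D j \<omega> < ereal (C j \<omega>)}"
  defines "B \<equiv> (\<integral>\<omega>. (LINT t:{0..T}|lborel. F t \<omega>) \<partial>M)"
  shows "B \<le> p * T + p / lambda_e" and "p * T - (1 - p) / lambda_e \<le> B"
proof -
  define A where "A \<omega> = (LINT t:{0..T}|lborel. F t \<omega>)" for \<omega>
  have p01: "0 \<le> p" "p \<le> 1" using p by auto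
  note freshness_measurable [measurable]
  have Am [measurable]: "A \<in> borel_measurable M"
    unfolding A_def set_lebesgue_integral_def by measurable
  have int: "integrable lborel (\<lambda>t. indicator {0..T} t * F t \<omega>)" if "\<omega> \<in> space M" for \<omega>
  proof (rule Bochner_Integration.integrable_bound)
    show "integrable lborel (indicator {0..T} :: real \<Rightarrow> real)"
      using T by (intro iffD2[OF integrable_indicator_iff]) simp
    have [measurable]: "(\<lambda>t. F t \<omega>) \<in> borel_measurable lborel"
      using measurable_compose[OF measurable_Pair1'[OF that] freshness_measurable] by simp
    show "(\<lambda>t. indicator {0..T} t * F t \<omega>) \<in> borel_measurable lborel" by measurable
  qed (auto simp: freshness_bounds split: split_indicator)
  \<comment> \<open>Translation from Bochner to nonnegative integrals along a path. The bounds 0 and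
    \<open>T\<close> on \<open>A\<close> make it integrable and keep \<open>ennreal\<close> from
    cutting off negative values.\<close>
  have A: "ennreal (A \<omega>) = (\<integral>\<^sup>+t. ennreal (F t \<omega>) * indicator {0..T} t \<partial>lborel)"
      "ennreal (T - A \<omega>) = (\<integral>\<^sup>+t. ennreal (1 - F t \<omega>) * indicator {0..T} t \<partial>lborel)"
      "0 \<le> A \<omega>" "A \<omega> \<le> T" if w: "\<omega> \<in> space M" for \<omega>
  proof -
    have "(\<integral>\<^sup>+t. ennreal (F t \<omega>) * indicator {0..T} t \<partial>lborel) = (\<integral>\<^sup>+t. ennreal (indicator {0..T} t * F t \<omega>) \<partial>lborel)"
      by (intro nn_integral_cong) (auto split: split_indicator)
    also have "\<dots> = ennreal (A \<omega>)"
      unfolding A_def set_lebesgue_integral_def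
      by (subst nn_integral_eq_integral[OF int[OF w]]) (auto simp: freshness_bounds)
    finally show "ennreal (A \<omega>) = (\<integral>\<^sup>+t. ennreal (F t \<omega>) * indicator {0..T} t \<partial>lborel)" ..
    have int': "integrable lborel (\<lambda>t. indicator {0..T} t - indicator {0..T} t * F t \<omega>)"
      using T by (intro Bochner_Integration.integrable_diff int w) (simp add: integrable_indicator_iff)
    have TA: "T - A \<omega> = (\<integral>t. (indicator {0..T} t - indicator {0..T} t * F t \<omega>) \<partial>lborel)"
      using T int[OF w] by (subst Bochner_Integration.integral_diff) (auto simp: A_def set_lebesgue_integral_def)
    have "(\<integral>\<^sup>+t. ennreal (1 - F t \<omega>) * indicator {0..T} t \<partial>lborel) =
        (\<integral>\<^sup>+t. ennreal (indicator {0..T} t - indicator {0..T} t * F t \<omega>) \<partial>lborel)"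
      by (intro nn_integral_cong) (auto split: split_indicator)
    also have "\<dots> = ennreal (T - A \<omega>)"
      unfolding TA
      by (subst nn_integral_eq_integral[OF int']) (auto simp: freshness_bounds split: split_indicator)
    finally show "ennreal (T - A \<omega>) = (\<integral>\<^sup>+t. ennreal (1 - F t \<omega>) * indicator {0..T} t \<partial>lborel)" ..
    show "0 \<le> A \<omega>"
      unfolding A_def set_lebesgue_integral_def by (rule integral_nonneg_AE) (auto simp: freshness_bounds)
    have "0 \<le> T - A \<omega>"
      unfolding TA by (rule integral_nonneg_AE) (auto simp: freshness_bounds split: split_indicator)
    then show "A \<omega> \<le> T" by simp
  qed
  have iA: "integrable M A"
    by (rule integrable_const_bound[of _ T]) (auto simp: A)
  have B: "B = (\<integral>\<omega>. A \<omega> \<partial>M)" by (simp add: B_def A_def)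
  have TB: "T - B = (\<integral>\<omega>. T - A \<omega> \<partial>M)"
    using iA by (simp add: B prob_space)
  have "ennreal B = (\<integral>\<^sup>+\<omega>. ennreal (A \<omega>) \<partial>M)"
    unfolding B using iA by (intro nn_integral_eq_integral[symmetric]) (auto simp: A)
  also have "\<dots> \<le> (\<integral>\<^sup>+\<omega>. (\<Sum>n. indicator {..T} (cycle_start C n \<omega>) * ennreal (C n \<omega> - delay n \<omega>)) \<partial>M)"
  proof (rule nn_integral_mono_AE)
    show "AE \<omega> in M. ennreal (A \<omega>) \<le>
        (\<Sum>n. indicator {..T} (cycle_start C n \<omega>) * ennreal (C n \<omega> - delay n \<omega>))"
      using freshness_integral_bounds(1)[OF T] AE_space
      by eventually_elim (simp add: A)
  qed
  also have "\<dots> = ennreal ((1 + lambda_e * T) * (p / lambda_e))"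
    using nn_integral_reward_sum[OF T, of "p / lambda_e" "\<lambda>(c, d). ennreal (c - truncated c d)"] p01 rate_pos
    by (simp add: nn_integral_cycle_rewards[OF p])
  finally have "B \<le> (1 + lambda_e * T) * (p / lambda_e)"
    using p01 rate_pos T by (subst (asm) ennreal_le_iff) auto
  then show "B \<le> p * T + p / lambda_e"
    using rate_pos by (simp add: field_simps)
  have "ennreal (T - B) = (\<integral>\<^sup>+\<omega>. ennreal (T - A \<omega>) \<partial>M)"
    unfolding TB using iA by (intro nn_integral_eq_integral[symmetric]) (auto simp: A)
  also have "\<dots> \<le> (\<integral>\<^sup>+\<omega>. (\<Sum>n. indicator {..T} (cycle_start C n \<omega>) * ennreal (delay n \<omega>)) \<partial>M)"
  proof (rule nn_integral_mono_AE)
    show "AE \<omega> in M. ennreal (T - A \<omega>) \<le>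
        (\<Sum>n. indicator {..T} (cycle_start C n \<omega>) * ennreal (delay n \<omega>))"
      using freshness_integral_bounds(2)[OF T] AE_space
      by eventually_elim (simp add: A)
  qed
  also have "\<dots> = ennreal ((1 + lambda_e * T) * ((1 - p) / lambda_e))"
    using nn_integral_reward_sum[OF T, of "(1 - p) / lambda_e" "\<lambda>(c, d). ennreal (truncated c d)"] p01 rate_pos
    by (simp add: nn_integral_cycle_rewards[OF p])
  finally have "T - B \<le> (1 + lambda_e * T) * ((1 - p) / lambda_e)"
    using p01 rate_pos T by (subst (asm) ennreal_le_iff) auto
  \<comment> \<open>The bound on \<open>T - B\<close> expands to
    \<open>(1 - p) * T + (1 - p) / lambda_e\<close>; subtracting it from \<open>T\<close> leaves
    \<open>p * T\<close> as the main term.\<close>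
  then show "p * T - (1 - p) / lambda_e \<le> B"
    using rate_pos by (simp add: field_simps)
qed

text \<open>The distance of the expected fresh time from \<open>p * T\<close> stays bounded, so it
  vanishes after division by \<open>T\<close>. The limit thus exists and agrees with the upper
  limit.\<close>

lemma average_freshness_eq:
  assumes p: "p = prob {\<omega>\<in>space M. D j \<omega> < ereal (C j \<omega>)}"
  shows "average_freshness M (source_version C) \<nu> = ereal p"
proof -
  let ?B = "\<lambda>T. (\<integral>\<omega>. (LINT t:{0..T}|lborel. F t \<omega>) \<partial>M)"
  have "((\<lambda>T. 1 / T * ?B T) \<longlongrightarrow> p) at_top"
  proof (rule tendsto_sandwich)
    show "\<forall>\<^sub>F T in at_top. p - (1 - p) / lambda_e / T \<le> 1 / T * ?B T"
      using eventually_gt_at_top[of 0]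
    proof eventually_elim
      case (elim T)
      then have "1 / T * (p * T) - 1 / T * ((1 - p) / lambda_e) \<le> 1 / T * ?B T"
        unfolding right_diff_distrib[symmetric]
        by (intro mult_left_mono expected_freshness_bounds(2)[OF _ p]) auto
      then show ?case using elim by (simp add: mult.commute)
    qed
    show "\<forall>\<^sub>F T in at_top. 1 / T * ?B T \<le> p + p / lambda_e / T"
      using eventually_gt_at_top[of 0]
    proof eventually_elim
      case (elim T)
      then have "1 / T * ?B T \<le> 1 / T * (p * T + p / lambda_e)"
        by (intro mult_left_mono expected_freshness_bounds(1)[OF _ p]) auto
      then show ?case using elim by (simp add: distrib_left mult.commute)
    qed
    show "((\<lambda>T. p - (1 - p) / lambda_e / T) \<longlongrightarrow> p) at_top"
      using tendsto_diff[OF tendsto_const[of p] tendsto_divide_0[OF tendsto_const[of "(1 - p) / lambda_e"] filterlim_at_top_imp_at_infinity[OF filterlim_ident]]]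
      by simp
    show "((\<lambda>T. p + p / lambda_e / T) \<longlongrightarrow> p) at_top"
      using tendsto_add[OF tendsto_const[of p] tendsto_divide_0[OF tendsto_const[of "p / lambda_e"] filterlim_at_top_imp_at_infinity[OF filterlim_ident]]]
      by simp
  qed
  then show ?thesis
    unfolding average_freshness_def by (intro lim_imp_Limsup) auto
qed

end

theorem mainTheorem1:
  fixes M :: "'a measure"
    and lambda_e p :: real
    and C :: "nat \<Rightarrow> 'a \<Rightarrow> real"
    and D :: "nat \<Rightarrow> 'a \<Rightarrow> ereal"
    and \<nu> :: "real \<Rightarrow> 'a \<Rightarrow> nat"
    and j :: nat
  assumes "gossip_node M lambda_e C D \<nu>"
    and "p = measure M {\<omega> \<in> space M. D j \<omega> < ereal (C j \<omega>)}"
  shows "average_freshness M (source_version C) \<nu>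
           = ereal (((1 - p) * 0 + p * (1 / lambda_e)) / (1 / lambda_e))
       \<and> ((1 - p) * 0 + p * (1 / lambda_e)) / (1 / lambda_e) = p"
proof -
  interpret gossip_node M lambda_e C D \<nu> by fact
  \<comment> \<open>As \<open>lambda_e\<close> is nonzero, the mean cycle length
    \<open>1 / lambda_e\<close> cancels in the quotient.\<close>
  show ?thesis
    using average_freshness_eq[OF assms(2)] rate_pos by simp
qed

end
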